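(* The Eilenberg-MacLane simplicial set $\operatorname{K}(M,n)$ of a commutative monoid $M$ is not necessarily a quasi-category. That is, there exist a commutative monoid $M$ and a natural number $n\geq 1$ such that the underlying simplicial set of the simplicial monoid $\operatorname{K}(M,n)$ is not a quasi-category.
   Context: Simplicial sets: $\Delta[n]$ denotes the standard $n$-simplex, whose $k$-simplices are the order-preserving maps $[k]\to[n]$, where $[m]=\{0<1<\dots<m\}$; $\partial\Delta[n]$ denotes its boundary (the simplicial subset of non-surjective maps). For a simplicial set $X$, $X[k]$ denotes its set of $k$-simplices. For $n\geq 1$, $S^n$ denotes the simplicial set $\Delta[n]/\partial\Delta[n]$, obtained by collapsing $\partial\Delta[n]$ to a single basepoint $*$ in each degree. Thus $S^n[k]$ consists of $*$ together with the surjective order-preserving maps $[k]\to[n]$. Eilenberg-MacLane construction: for a commutative monoid $M$ (written additively) and a natural number $n\geq 1$, $\operatorname{K}(M,n)$ is the simplicial (commutative) monoid whose monoid of $k$-simplices is the reduced free monoid $M(S^n[k])$ generated by the pointed set $S^n[k]$ over $M$, i.e. the direct sum $\bigoplus_{x\in S^n[k]\setminus\{*\}} M\langle x\rangle$ of copies of $M$ indexed by the non-basepoint elements of $S^n[k]$ (the basepoint is identified with zero). The simplicial structure is induced from that of $S^n$: for an order-preserving map $\theta:[l]\to[k]$, the induced homomorphism $\theta^*:M(S^n[k])\to M(S^n[l])$ sends the family $(m_x)_{x\neq *}$ to the family whose component at $y\in S^n[l]\setminus\{*\}$ is $\sum_{x\in S^n[k]\setminus\{*\},\ \theta^*x=y}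 m_x$ (summands with $\theta^*x=*$ are sent to zero). Quasi-category: for $m\geq 0$ and $k\in[m]$, $\Lambda^k[m]\subset\Delta[m]$ denotes the simplicial subset generated by the faces $\delta_i$ with $i\in[m]\setminus\{k\}$, where $\delta_i:[m-1]\to[m]$ is the injective order-preserving map omitting $i$. A simplicial set $X$ is a quasi-category if for every $m$ and every $k\in[m]\setminus\{0,m\}$, every map of simplicial sets $\Lambda^k[m]\to X$ extends along the inclusion $\Lambda^k[m]\subset\Delta[m]$ to a map $\Delta[m]\to X$. *)

theory Defs
  imports "HOL-Algebra.Free_Abelian_Groups"
begin

section \<open>Order-preserving maps\<close>

text \<open>The set of order-preserving maps \<open>[l] \<rightarrow> [k]\<close>, where \<open>[m] = {..m}\<close>.  The maps are
  extensional (\<open>undefined\<close> outside \<open>{..l}\<close>), so that equality of functions is equality of maps;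
  accordingly \<open>\<eta>\<close> followed by \<open>\<theta>\<close>, with \<open>\<eta>\<close> having source \<open>[j]\<close>, is \<open>compose {..j} \<theta> \<eta>\<close>.\<close>

definition ord_maps :: "nat \<Rightarrow> nat \<Rightarrow> (nat \<Rightarrow> nat) set" where
  "ord_maps l k = {\<theta> \<in> {..l} \<rightarrow>\<^sub>E {..k}. mono_on {..l} \<theta>}"

text \<open>For \<open>m \<ge> 1\<close> and \<open>i \<le> m\<close>: the injective order-preserving map \<open>[m - 1] \<rightarrow> [m]\<close> omitting \<open>i\<close>.\<close>

definition face_map :: "nat \<Rightarrow> nat \<Rightarrow> (nat \<Rightarrow> nat)" where
  "face_map m i = (\<lambda>j\<in>{..m - 1}. if j < i then j else Suc j)"

section \<open>Simplicial sets\<close>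

text \<open>\<open>pull X k l \<theta> : X[k] \<rightarrow> X[l]\<close> is the map induced by \<open>\<theta> : [l] \<rightarrow> [k]\<close>.\<close>

record 'a sset =
  simplices :: "nat \<Rightarrow> 'a set"
  pull :: "nat \<Rightarrow> nat \<Rightarrow> (nat \<Rightarrow> nat) \<Rightarrow> 'a \<Rightarrow> 'a"

locale simplicial_set =
  fixes X :: "'a sset"
  assumes pull_closed:
      "\<lbrakk>\<theta> \<in> ord_maps l k; x \<in> simplices X k\<rbrakk> \<Longrightarrow> pull X k l \<theta> x \<in> simplices X l"
    and pull_id:
      "x \<in> simplices X k \<Longrightarrow> pull X k k (\<lambda>i\<in>{..k}. i) x = x"
    and pull_comp:
      "\<lbrakk>\<theta> \<in> ord_maps l k; \<eta> \<in> ord_maps j l; x \<in> simplices X k\<rbrakk>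
        \<Longrightarrow> pull X l j \<eta> (pull X k l \<theta> x) = pull X k j (compose {..j} \<theta> \<eta>) x"

definition sset_map :: "'a sset \<Rightarrow> 'b sset \<Rightarrow> (nat \<Rightarrow> 'a \<Rightarrow> 'b) \<Rightarrow> bool" where
  "sset_map X Y f \<longleftrightarrow>
     (\<forall>k. f k \<in> simplices X k \<rightarrow> simplices Y k) \<and>
     (\<forall>k l. \<forall>\<theta>\<in>ord_maps l k. \<forall>x\<in>simplices X k. f l (pull X k l \<theta> x) = pull Y k l \<theta> (f k x))"

text \<open>The simplicial subset generated by a set \<open>G\<close> of simplices, each paired with its dimension.\<close>

definition generated_subset :: "'a sset \<Rightarrow> (nat \<times> 'a) set \<Rightarrow> 'a sset" where
  "generated_subset X G =
     X\<lparr>simplices := \<lambda>k. {pull X d k \<theta> g | d g \<theta>. (d, g) \<in> G \<and> \<theta> \<in> ord_maps k d}\<rparr>"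

text \<open>The quotient \<open>X/A\<close> of \<open>X\<close> by a simplicial subset \<open>A\<close>: the basepoint in each degree is \<open>None\<close>,
  and \<open>Some x\<close> is the class of a simplex \<open>x\<close> outside \<open>A\<close>.\<close>

definition quotient_sset :: "'a sset \<Rightarrow> 'a sset \<Rightarrow> 'a option sset" where
  "quotient_sset X A =
     \<lparr>simplices = \<lambda>k. insert None (Some ` (simplices X k - simplices A k)),
      pull = \<lambda>k l \<theta> z. (case z of None \<Rightarrow> None
        | Some x \<Rightarrow> if pull X k l \<theta> x \<in> simplices A l then None else Some (pull X k l \<theta> x))\<rparr>"

definition std_simplex :: "nat \<Rightarrow> (nat \<Rightarrow> nat) sset" where
  "std_simplex n =
     \<lparr>simplices = \<lambda>k. ord_maps k n, pull = \<lambda>k l \<theta> x. compose {..l} x \<theta>\<rparr>"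

definition boundary :: "nat \<Rightarrow> (nat \<Rightarrow> nat) sset" where
  "boundary n = (std_simplex n)\<lparr>simplices := \<lambda>k. {x \<in> ord_maps k n. x ` {..k} \<noteq> {..n}}\<rparr>"

definition horn :: "nat \<Rightarrow> nat \<Rightarrow> (nat \<Rightarrow> nat) sset" where
  "horn m k = generated_subset (std_simplex m) {(m - 1, face_map m i) | i. i \<in> {..m} - {k}}"

definition sphere :: "nat \<Rightarrow> (nat \<Rightarrow> nat) option sset" where
  "sphere n = quotient_sset (std_simplex n) (boundary n)"

text \<open>A property of simplicial sets: it is meant to be applied to \<open>X\<close> with \<open>simplicial_set X\<close>.\<close>

definition quasi_category :: "'a sset \<Rightarrow> bool" where
  "quasi_category X \<longleftrightarrow>
     (\<forall>m. \<forall>k\<in>{..m} - {0, m}. \<forall>f. sset_map (horn m k) X f \<longrightarrow>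
        (\<exists>g. sset_map (std_simplex m) X g \<and> (\<forall>j. \<forall>x\<in>simplices (horn m k) j. g j x = f j x)))"

section \<open>The Eilenberg-MacLane construction\<close>

text \<open>\<open>HOL-Algebra\<close> writes commutative monoids multiplicatively.  The direct sum of copies of \<open>M\<close>
  indexed by the non-basepoint elements of the pointed set \<open>(X, b)\<close> is the part of the product
  that consists of the families of finite support.\<close>

definition reduced_free_monoid :: "'a monoid \<Rightarrow> 'x set \<Rightarrow> 'x \<Rightarrow> ('x \<Rightarrow> 'a) monoid" where
  "reduced_free_monoid M X b =
     (product_group (X - {b}) (\<lambda>_. M))
       \<lparr>carrier := {m \<in> (X - {b}) \<rightarrow>\<^sub>E carrier M. finite {x \<in> X - {b}. m x \<noteq> \<one>\<^bsub>M\<^esub>}}\<rparr>"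

text \<open>The homomorphism induced by a pointed map \<open>\<phi> : (X, b) \<rightarrow> (Y, c)\<close>; \<open>gfinprod\<close> is the product
  of a family of finite support.\<close>

definition reduced_free_map ::
  "'a monoid \<Rightarrow> 'x set \<Rightarrow> 'x \<Rightarrow> 'y set \<Rightarrow> 'y \<Rightarrow> ('x \<Rightarrow> 'y) \<Rightarrow> ('x \<Rightarrow> 'a) \<Rightarrow> ('y \<Rightarrow> 'a)" where
  "reduced_free_map M X b Y c \<phi> m = (\<lambda>y\<in>Y - {c}. gfinprod M m {x \<in> X - {b}. \<phi> x = y})"

record 'a smonoid =
  monoid_at :: "nat \<Rightarrow> 'a monoid"
  mpull :: "nat \<Rightarrow> nat \<Rightarrow> (nat \<Rightarrow> nat) \<Rightarrow> 'a \<Rightarrow> 'a"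

definition underlying_sset :: "'a smonoid \<Rightarrow> 'a sset" where
  "underlying_sset K = \<lparr>simplices = \<lambda>k. carrier (monoid_at K k), pull = mpull K\<rparr>"

locale simplicial_comm_monoid = simplicial_set "underlying_sset K" for K :: "'a smonoid" +
  assumes comm_monoid_at: "comm_monoid (monoid_at K k)"
    and mpull_hom: "\<theta> \<in> ord_maps l k \<Longrightarrow> mpull K k l \<theta> \<in> hom (monoid_at K k) (monoid_at K l)"
    and mpull_one: "\<theta> \<in> ord_maps l k \<Longrightarrow> mpull K k l \<theta> \<one>\<^bsub>monoid_at K k\<^esub> = \<one>\<^bsub>monoid_at K l\<^esub>"

definition eilenberg_maclane ::
  "'a monoid \<Rightarrow> nat \<Rightarrow> ((nat \<Rightarrow> nat) option \<Rightarrow> 'a) smonoid" where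
  "eilenberg_maclane M n =
     \<lparr>monoid_at = \<lambda>k. reduced_free_monoid M (simplices (sphere n) k) None,
      mpull = \<lambda>k l \<theta>. reduced_free_map M (simplices (sphere n) k) None
                         (simplices (sphere n) l) None (pull (sphere n) k l \<theta>)\<rparr>"

section \<open>Well-definedness\<close>

lemma ord_maps_compose:
  assumes "\<theta> \<in> ord_maps l k" "\<eta> \<in> ord_maps j l"
  shows "compose {..j} \<theta> \<eta> \<in> ord_maps j k"
  using assms unfolding ord_maps_def compose_def mono_on_def
  by (auto simp: PiE_iff)

lemma ord_maps_compose_assoc:
  assumes "\<eta> \<in> ord_maps j l"
  shows "compose {..j} (compose {..l} x \<theta>) \<eta> = compose {..j} x (compose {..j} \<theta> \<eta>)"
  using assms unfolding ord_maps_def compose_def by (auto simp: PiE_iff)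

lemma finite_ord_maps: "finite (ord_maps l k)"
  unfolding ord_maps_def by (rule finite_subset[of _ "{..l} \<rightarrow>\<^sub>E {..k}"]) (auto intro: finite_PiE)

lemma face_map_ord_maps: "m \<ge> 1 \<Longrightarrow> i \<le> m \<Longrightarrow> face_map m i \<in> ord_maps (m - 1) m"
  unfolding ord_maps_def face_map_def by (auto simp: mono_on_def)

lemma simplicial_set_std_simplex: "simplicial_set (std_simplex n)"
proof
  fix x k assume "x \<in> simplices (std_simplex n) k"
  then show "pull (std_simplex n) k k (\<lambda>i\<in>{..k}. i) x = x"
    by (auto simp: std_simplex_def ord_maps_def compose_def PiE_iff extensional_def)
qed (auto simp: std_simplex_def ord_maps_compose ord_maps_compose_assoc)

lemma simplicial_set_boundary: "simplicial_set (boundary n)"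
proof
  fix \<theta> l k x assume "\<theta> \<in> ord_maps l k" "x \<in> simplices (boundary n) k"
  then have th: "\<theta> \<in> ord_maps l k" and x: "x \<in> ord_maps k n" "x ` {..k} \<noteq> {..n}"
    by (auto simp: boundary_def)
  have "compose {..l} x \<theta> ` {..l} \<subseteq> x ` {..k}"
    using th by (auto simp: compose_def ord_maps_def)
  moreover have "x ` {..k} \<subset> {..n}" using x by (auto simp: ord_maps_def)
  ultimately show "pull (boundary n) k l \<theta> x \<in> simplices (boundary n) l"
    using ord_maps_compose[OF x(1) th] by (auto simp: boundary_def std_simplex_def)
next
  fix x k assume "x \<in> simplices (boundary n) k"
  then show "pull (boundary n) k k (\<lambda>i\<in>{..k}. i) x = x"
    by (auto simp: boundary_def std_simplex_def ord_maps_def compose_def PiE_iff extensional_def)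
qed (auto simp: boundary_def std_simplex_def ord_maps_compose_assoc)

lemma simplicial_set_generated_subset:
  assumes X: "simplicial_set X" and G: "\<And>d g. (d, g) \<in> G \<Longrightarrow> g \<in> simplices X d"
  shows "simplicial_set (generated_subset X G)"
proof -
  interpret X: simplicial_set X by (rule X)
  have sub: "x \<in> simplices X k" if "x \<in> simplices (generated_subset X G) k" for x k
    using that G by (auto simp: generated_subset_def intro: X.pull_closed)
  show ?thesis
  proof
    fix \<theta> l k x assume th: "\<theta> \<in> ord_maps l k" and "x \<in> simplices (generated_subset X G) k"
    then obtain d g \<eta> where "(d, g) \<in> G" "\<eta> \<in> ord_maps k d" "x = pull X d k \<eta> g"
      by (auto simp: generated_subset_def)
    then show "pull (generated_subset X G) k l \<theta> x \<in> simplices (generated_subset X G) l"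
      using th G[of d g] X.pull_comp[of \<eta> k d \<theta> l g] ord_maps_compose[of \<eta> k d \<theta> l]
      by (auto simp: generated_subset_def)
  next
    fix x k assume "x \<in> simplices (generated_subset X G) k"
    then show "pull (generated_subset X G) k k (\<lambda>i\<in>{..k}. i) x = x"
      using sub X.pull_id by (auto simp: generated_subset_def)
  next
    fix \<theta> l k \<eta> j x
    assume "\<theta> \<in> ord_maps l k" "\<eta> \<in> ord_maps j l" "x \<in> simplices (generated_subset X G) k"
    then show "pull (generated_subset X G) l j \<eta> (pull (generated_subset X G) k l \<theta> x)
        = pull (generated_subset X G) k j (compose {..j} \<theta> \<eta>) x"
      using sub[of x k] X.pull_comp[of \<theta> l k \<eta> j x] by (simp add: generated_subset_def)
  qed
qed

lemma simplicial_set_horn: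
  assumes "m \<ge> 1" shows "simplicial_set (horn m k)"
  unfolding horn_def
  by (rule simplicial_set_generated_subset[OF simplicial_set_std_simplex])
     (use assms face_map_ord_maps in \<open>auto simp: std_simplex_def\<close>)

lemma simplicial_set_quotient:
  assumes X: "simplicial_set X" and A: "simplicial_set A"
    and sub: "\<And>k. simplices A k \<subseteq> simplices X k" "pull A = pull X"
  shows "simplicial_set (quotient_sset X A)"
proof -
  interpret X: simplicial_set X by (rule X)
  interpret A: simplicial_set A by (rule A)
  show ?thesis
  proof
    fix \<theta> l k x assume "\<theta> \<in> ord_maps l k" "x \<in> simplices (quotient_sset X A) k"
    then show "pull (quotient_sset X A) k l \<theta> x \<in> simplices (quotient_sset X A) l"
      by (auto simp: quotient_sset_def X.pull_closed split: option.splits)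
  next
    fix x k assume "x \<in> simplices (quotient_sset X A) k"
    then show "pull (quotient_sset X A) k k (\<lambda>i\<in>{..k}. i) x = x"
      by (auto simp: quotient_sset_def X.pull_id split: option.splits)
  next
    fix \<theta> l k \<eta> j x
    assume "\<theta> \<in> ord_maps l k" "\<eta> \<in> ord_maps j l" "x \<in> simplices (quotient_sset X A) k"
    then show "pull (quotient_sset X A) l j \<eta> (pull (quotient_sset X A) k l \<theta> x)
        = pull (quotient_sset X A) k j (compose {..j} \<theta> \<eta>) x"
      using A.pull_closed[of \<eta> j l] sub(2)
      by (auto simp: quotient_sset_def X.pull_comp[symmetric] split: option.splits)
  qed
qed

lemma simplicial_set_sphere: "simplicial_set (sphere n)"
  unfolding sphere_def
  by (rule simplicial_set_quotient[OF simplicial_set_std_simplex simplicial_set_boundary])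
     (auto simp: boundary_def std_simplex_def)

lemma simplices_sphere:
  "simplices (sphere n) k = insert None (Some ` {x \<in> ord_maps k n. x ` {..k} = {..n}})"
  by (auto simp: sphere_def quotient_sset_def std_simplex_def boundary_def)

lemma finite_simplices_sphere: "finite (simplices (sphere n) k)"
  by (simp add: simplices_sphere finite_ord_maps)

lemma pull_sphere_None [simp]: "pull (sphere n) k l \<theta> None = None"
  by (simp add: sphere_def quotient_sset_def)

lemma carrier_reduced_free_monoid:
  "finite X \<Longrightarrow> carrier (reduced_free_monoid M X b) = (X - {b}) \<rightarrow>\<^sub>E carrier M"
  by (auto simp: reduced_free_monoid_def)

lemma one_reduced_free_monoid: "\<one>\<^bsub>reduced_free_monoid M X b\<^esub> = (\<lambda>x\<in>X - {b}. \<one>\<^bsub>M\<^esub>)"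
  by (simp add: reduced_free_monoid_def product_group_def)

lemma mult_reduced_free_monoid:
  "m \<otimes>\<^bsub>reduced_free_monoid M X b\<^esub> m' = (\<lambda>x\<in>X - {b}. m x \<otimes>\<^bsub>M\<^esub> m' x)"
  by (simp add: reduced_free_monoid_def product_group_def)

lemma comm_monoid_reduced_free_monoid:
  assumes "comm_monoid M"
  shows "comm_monoid (reduced_free_monoid M X b)"
proof -
  interpret M: comm_monoid M by (rule assms)
  have fin: "finite {x \<in> X - {b}. (m \<otimes>\<^bsub>reduced_free_monoid M X b\<^esub> m') x \<noteq> \<one>\<^bsub>M\<^esub>}"
    if "finite {x \<in> X - {b}. m x \<noteq> \<one>\<^bsub>M\<^esub>}" "finite {x \<in> X - {b}. m' x \<noteq> \<one>\<^bsub>M\<^esub>}" for m m'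
    by (rule finite_subset[OF _ finite_UnI[OF that]]) (auto simp: mult_reduced_free_monoid)
  have car: "m \<in> carrier (reduced_free_monoid M X b) \<longleftrightarrow>
      m \<in> (X - {b}) \<rightarrow>\<^sub>E carrier M \<and> finite {x \<in> X - {b}. m x \<noteq> \<one>\<^bsub>M\<^esub>}" for m
    by (simp add: reduced_free_monoid_def)
  show ?thesis
  proof (rule comm_monoidI)
    fix m m' assume "m \<in> carrier (reduced_free_monoid M X b)"
      "m' \<in> carrier (reduced_free_monoid M X b)"
    then show "m \<otimes>\<^bsub>reduced_free_monoid M X b\<^esub> m' \<in> carrier (reduced_free_monoid M X b)"
      using fin[of m m'] unfolding car by (auto simp: mult_reduced_free_monoid PiE_iff)
    show "m \<otimes>\<^bsub>reduced_free_monoid M X b\<^esub> m' = m' \<otimes>\<^bsub>reduced_free_monoid M X b\<^esub> m"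
      using \<open>m \<in> _\<close> \<open>m' \<in> _\<close> unfolding car
      by (auto simp: mult_reduced_free_monoid PiE_iff M.m_comm)
  next
    show "\<one>\<^bsub>reduced_free_monoid M X b\<^esub> \<in> carrier (reduced_free_monoid M X b)"
      unfolding car by (auto simp: one_reduced_free_monoid cong: conj_cong)
  next
    fix m assume "m \<in> carrier (reduced_free_monoid M X b)"
    then show "\<one>\<^bsub>reduced_free_monoid M X b\<^esub> \<otimes>\<^bsub>reduced_free_monoid M X b\<^esub> m = m"
      unfolding car
      by (auto simp: mult_reduced_free_monoid one_reduced_free_monoid PiE_iff extensional_def
          fun_eq_iff)
  next
    fix m m' m'' assume "m \<in> carrier (reduced_free_monoid M X b)"
      "m' \<in> carrier (reduced_free_monoid M X b)" "m'' \<in> carrier (reduced_free_monoid M X b)"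
    then show "m \<otimes>\<^bsub>reduced_free_monoid M X b\<^esub> m' \<otimes>\<^bsub>reduced_free_monoid M X b\<^esub> m''
        = m \<otimes>\<^bsub>reduced_free_monoid M X b\<^esub> (m' \<otimes>\<^bsub>reduced_free_monoid M X b\<^esub> m'')"
      unfolding car
      by (auto simp: mult_reduced_free_monoid PiE_iff M.m_assoc fun_eq_iff)
  qed
qed

lemma reduced_free_map_eq_finprod:
  assumes "comm_monoid M" "finite X" "m \<in> carrier (reduced_free_monoid M X b)"
  shows "reduced_free_map M X b Y c \<phi> m
    = (\<lambda>y\<in>Y - {c}. finprod M m {x \<in> X - {b}. \<phi> x = y})"
proof -
  interpret M: comm_monoid M by (rule assms)
  show ?thesis
    using assms(2,3) unfolding reduced_free_map_def carrier_reduced_free_monoid[OF assms(2)]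
    by (intro restrict_ext M.gfinprod_eq_finprod) auto
qed

lemma simplicial_comm_monoid_eilenberg_maclane:
  assumes M: "comm_monoid M"
  shows "simplicial_comm_monoid (eilenberg_maclane M n)"
proof -
  interpret M: comm_monoid M by (rule M)
  interpret S: simplicial_set "sphere n" by (rule simplicial_set_sphere)
  define S where "S = simplices (sphere n)"
  let ?K = "eilenberg_maclane M n"
  have finS: "finite (S k)" for k by (simp add: S_def finite_simplices_sphere)
  have at: "monoid_at ?K k = reduced_free_monoid M (S k) None" for k
    by (simp add: eilenberg_maclane_def S_def)
  have car: "carrier (monoid_at ?K k) = (S k - {None}) \<rightarrow>\<^sub>E carrier M" for k
    by (simp add: at carrier_reduced_free_monoid finS)
  have mp: "mpull ?K k l \<theta> m
      = (\<lambda>y\<in>S l - {None}. finprod M m {x \<in> S k - {None}. pull (sphere n) k l \<theta> x = y})"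
    if "m \<in> carrier (monoid_at ?K k)" for k l \<theta> m
    using reduced_free_map_eq_finprod[OF M finS that[unfolded at]]
    unfolding eilenberg_maclane_def S_def by simp
  have cl: "mpull ?K k l \<theta> m \<in> carrier (monoid_at ?K l)" if "m \<in> carrier (monoid_at ?K k)"
    for k l \<theta> m
    unfolding mp[OF that] unfolding car using that[unfolded car]
    by (intro restrict_PiE_iff[THEN iffD2] ballI M.finprod_closed) auto
  have cm: "comm_monoid (monoid_at ?K k)" for k
    by (simp add: at comm_monoid_reduced_free_monoid M)
  show ?thesis
  proof (intro simplicial_comm_monoid.intro simplicial_set.intro simplicial_comm_monoid_axioms.intro)
    fix \<theta> l k x assume "x \<in> simplices (underlying_sset ?K) k"
    then show "pull (underlying_sset ?K) k l \<theta> x \<in> simplices (underlying_sset ?K) l"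
      by (simp add: underlying_sset_def cl)
  next
    fix x k assume "x \<in> simplices (underlying_sset ?K) k"
    then have x: "x \<in> carrier (monoid_at ?K k)" by (simp add: underlying_sset_def)
    have "finprod M x {z \<in> S k - {None}. pull (sphere n) k k (\<lambda>i\<in>{..k}. i) z = y} = x y"
      if y: "y \<in> S k - {None}" for y
    proof -
      have "{z \<in> S k - {None}. pull (sphere n) k k (\<lambda>i\<in>{..k}. i) z = y} = {y}"
        using y S.pull_id by (auto simp: S_def)
      then show ?thesis using x y unfolding car by (auto simp: PiE_iff)
    qed
    then show "pull (underlying_sset ?K) k k (\<lambda>i\<in>{..k}. i) x = x"
      using x by (auto simp: underlying_sset_def mp car PiE_iff extensional_def fun_eq_iff)
  next
    fix \<theta> l k \<eta> j x
    assume th: "\<theta> \<in> ord_maps l k" and et: "\<eta> \<in> ord_maps j l"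
      and "x \<in> simplices (underlying_sset ?K) k"
    then have x: "x \<in> carrier (monoid_at ?K k)" by (simp add: underlying_sset_def)
    have x': "z \<in> S k - {None} \<Longrightarrow> x z \<in> carrier M" for z using x unfolding car by auto
    let ?p = "pull (sphere n) k l \<theta>" and ?q = "pull (sphere n) l j \<eta>"
    let ?r = "pull (sphere n) k j (compose {..j} \<theta> \<eta>)"
    have "finprod M (\<lambda>y\<in>S l - {None}. finprod M x {z \<in> S k - {None}. ?p z = y})
             {y \<in> S l - {None}. ?q y = w}
        = finprod M x {z \<in> S k - {None}. ?r z = w}" if w: "w \<in> S j - {None}" for w
    proof -
      have un: "{z \<in> S k - {None}. ?r z = w}
          = (\<Union>y\<in>{y \<in> S l - {None}. ?q y = w}. {z \<in> S k - {None}. ?p z = y})" (is "?L = ?R")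
      proof
        show "?L \<subseteq> ?R"
        proof
          fix z assume z: "z \<in> ?L"
          then have "?q (?p z) = w" using S.pull_comp[OF th et, of z] by (simp add: S_def)
          moreover have "?p z \<in> S l" using S.pull_closed[OF th] z by (simp add: S_def)
          ultimately show "z \<in> ?R" using z w by (cases "?p z = None") auto
        qed
        show "?R \<subseteq> ?L" using S.pull_comp[OF th et, symmetric] by (auto simp: S_def)
      qed
      have "finprod M x ?L
          = finprod M (\<lambda>y. finprod M x {z \<in> S k - {None}. ?p z = y}) {y \<in> S l - {None}. ?q y = w}"
        unfolding un
        by (rule M.finprod_UN_disjoint) (use finS x' in \<open>auto simp: pairwise_def disjnt_def\<close>)
      also have "\<dots> = finprod M (\<lambda>y\<in>S l - {None}. finprod M x {z \<in> S k - {None}. ?p z = y})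
             {y \<in> S l - {None}. ?q y = w}"
        by (rule M.finprod_cong') (use x' in \<open>auto intro!: M.finprod_closed\<close>)
      finally show ?thesis by simp
    qed
    then show "pull (underlying_sset ?K) l j \<eta> (pull (underlying_sset ?K) k l \<theta> x)
        = pull (underlying_sset ?K) k j (compose {..j} \<theta> \<eta>) x"
      using x cl[OF x, of l \<theta>] by (auto simp: underlying_sset_def mp)
  next
    fix k show "comm_monoid (monoid_at ?K k)" by (rule cm)
  next
    fix \<theta> l k
    show "mpull ?K k l \<theta> \<in> hom (monoid_at ?K k) (monoid_at ?K l)"
    proof (rule homI)
      fix x assume "x \<in> carrier (monoid_at ?K k)"
      then show "mpull ?K k l \<theta> x \<in> carrier (monoid_at ?K l)" by (rule cl)
    next
      fix x y assume xy: "x \<in> carrier (monoid_at ?K k)" "y \<in> carrier (monoid_at ?K k)"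
      interpret K: comm_monoid "monoid_at ?K k" by (rule cm)
      have m: "x \<otimes>\<^bsub>monoid_at ?K k\<^esub> y \<in> carrier (monoid_at ?K k)" using xy by simp
      have *: "finprod M (\<lambda>z\<in>S k - {None}. x z \<otimes>\<^bsub>M\<^esub> y z) B = finprod M x B \<otimes>\<^bsub>M\<^esub> finprod M y B"
        if "B \<subseteq> S k - {None}" for B
      proof -
        have fx: "x \<in> B \<rightarrow> carrier M" "y \<in> B \<rightarrow> carrier M" using xy that unfolding car by auto
        have "finprod M (\<lambda>z\<in>S k - {None}. x z \<otimes>\<^bsub>M\<^esub> y z) B = finprod M (\<lambda>z. x z \<otimes>\<^bsub>M\<^esub> y z) B"
          by (rule M.finprod_cong') (use fx that in auto)
        then show ?thesis using M.finprod_multf[OF fx] by simp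
      qed
      show "mpull ?K k l \<theta> (x \<otimes>\<^bsub>monoid_at ?K k\<^esub> y)
          = mpull ?K k l \<theta> x \<otimes>\<^bsub>monoid_at ?K l\<^esub> mpull ?K k l \<theta> y"
        unfolding mp[OF m] mp[OF xy(1)] mp[OF xy(2)]
        unfolding at mult_reduced_free_monoid by (intro restrict_ext) (simp, rule *, auto)
    qed
    interpret K: comm_monoid "monoid_at ?K k" by (rule cm)
    show "mpull ?K k l \<theta> \<one>\<^bsub>monoid_at ?K k\<^esub> = \<one>\<^bsub>monoid_at ?K l\<^esub>"
      unfolding mp[OF K.one_closed] unfolding at one_reduced_free_monoid
      by (intro restrict_ext M.finprod_one_eqI) auto
  qed
qed

end

theory Submission
  imports Defs
begin

text \<open>For \<open>n \<ge> 2\<close>, horn filling in \<open>K(M,n)\<close> forces every element of \<open>M\<close> to be invertible.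
  In dimensions below \<open>n\<close> there is only the zero simplex, and an \<open>n\<close>-simplex is an element of
  \<open>M\<close>, so any choice of elements of \<open>M\<close> on the faces of an \<open>(n + 1)\<close>-dimensional horn is
  compatible.  An \<open>(n + 1)\<close>-simplex, on the other hand, is a family \<open>(a\<^sub>0, \<dots>, a\<^sub>n)\<close>, indexed by the
  degeneracies \<open>[n + 1] \<rightarrow> [n]\<close>; its last face is \<open>a\<^sub>n\<close> and its face opposite to the vertex
  \<open>n\<close> is \<open>a\<^sub>n\<^sub>-\<^sub>1 + a\<^sub>n\<close>.  The horn that omits only the face opposite to \<open>n - 1\<close> contains both
  of them, and it is an inner horn exactly because \<open>n \<ge> 2\<close>.  Put \<open>b\<close> on the last face and zero
  on the others: a filler satisfies \<open>a\<^sub>n = b\<close> and \<open>a\<^sub>n\<^sub>-\<^sub>1 + a\<^sub>n = 0\<close>, so \<open>a\<^sub>n\<^sub>-\<^sub>1\<close> is an inverse of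
  \<open>b\<close>.  Hence \<open>M\<close> is a group, which the natural numbers under addition are not.

  The horn is written down in \<open>sset_map_last_face_horn\<close>, and the inverse is read off from a filler
  in \<open>group_if_quasi_category_eilenberg_maclane\<close>.\<close>

lemma simplices_eilenberg_maclane:
  "simplices (underlying_sset (eilenberg_maclane M n)) k
     = (simplices (sphere n) k - {None}) \<rightarrow>\<^sub>E carrier M"
  by (simp add: underlying_sset_def eilenberg_maclane_def carrier_reduced_free_monoid
      finite_simplices_sphere)

lemma pull_eilenberg_maclane:
  assumes "comm_monoid M" "m \<in> simplices (underlying_sset (eilenberg_maclane M n)) k"
  shows "pull (underlying_sset (eilenberg_maclane M n)) k l \<theta> m
    = (\<lambda>y\<in>simplices (sphere n) l - {None}.
         finprod M m {z \<in> simplices (sphere n) k - {None}. pull (sphere n) k l \<theta> z = y})"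
  using assms(2) unfolding underlying_sset_def eilenberg_maclane_def
  by (simp only: sset.simps smonoid.simps
      reduced_free_map_eq_finprod[OF assms(1) finite_simplices_sphere])

lemma pull_sphere_Some:
  "pull (sphere n) k l \<theta> (Some x) =
     (if compose {..l} x \<theta> \<in> ord_maps l n \<and> compose {..l} x \<theta> ` {..l} \<noteq> {..n} then None
      else Some (compose {..l} x \<theta>))"
  by (simp add: sphere_def quotient_sset_def boundary_def std_simplex_def)

lemma pull_horn: "pull (horn m k) = pull (std_simplex m)"
  by (simp add: horn_def generated_subset_def)

lemma simplices_horn:
  "simplices (horn m k) j
     = {compose {..j} (face_map m i) \<theta> | i \<theta>. i \<in> {..m} - {k} \<and> \<theta> \<in> ord_maps j (m - 1)}"
  by (auto simp: horn_def generated_subset_def std_simplex_def)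

lemma face_map_in_horn:
  assumes "i \<le> m" "i \<noteq> k"
  shows "face_map m i \<in> simplices (horn m k) (m - 1)"
proof -
  have "face_map m i = compose {..m - 1} (face_map m i) (\<lambda>j\<in>{..m - 1}. j)"
    by (auto simp: compose_def face_map_def)
  moreover have "(\<lambda>j\<in>{..m - 1}. j) \<in> ord_maps (m - 1) (m - 1)"
    by (auto simp: ord_maps_def mono_on_def)
  ultimately show ?thesis
    unfolding simplices_horn using assms by blast
qed

text \<open>A simplex of a horn misses some vertex; when it contains all the vertices of the last face,
  the missing vertex can only be the last one.\<close>

lemma horn_simplex_last_face:
  assumes x: "x \<in> simplices (horn (Suc n) k) j" and sub: "{..n} \<subseteq> x ` {..j}"
  shows "x \<in> ord_maps j n" "x ` {..j} = {..n}"
proof -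
  from x obtain i \<theta> where i: "i \<le> Suc n" and th: "\<theta> \<in> ord_maps j n"
    and x_eq: "x = compose {..j} (face_map (Suc n) i) \<theta>"
    by (auto simp: simplices_horn)
  have x_ord: "x \<in> ord_maps j (Suc n)"
    unfolding x_eq using i th face_map_ord_maps[of "Suc n" i] by (intro ord_maps_compose) auto
  have "i \<notin> x ` {..j}"
    using th by (auto simp: x_eq compose_def face_map_def ord_maps_def split: if_splits)
  with sub i have "i = Suc n" by (meson atMost_iff le_SucE subsetD)
  moreover have "x ` {..j} \<subseteq> {..Suc n}" using x_ord by (auto simp: ord_maps_def)
  ultimately have le: "x ` {..j} \<subseteq> {..n}"
    using \<open>i \<notin> x ` {..j}\<close> by (simp add: atMost_Suc subset_insert)
  then show "x \<in> ord_maps j n" using x_ord by (auto simp: ord_maps_def PiE_iff)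
  show "x ` {..j} = {..n}" using le sub by auto
qed

text \<open>This is the map that is \<open>b\<close> on the last face and zero on the other faces.  The last face
  \<open>[n] \<rightarrow> [n + 1]\<close> is an inclusion, so its degeneracies are literally the surjections
  \<open>[j] \<rightarrow> [n]\<close>: comparing \<open>y\<close> with \<open>x\<close> itself describes the map in all degrees at once.  Naturality
  holds because a simplex of the horn with a pullback onto \<open>[n]\<close> is itself onto \<open>[n]\<close>.\<close>

lemma sset_map_last_face_horn:
  assumes M: "comm_monoid M" and b: "b \<in> carrier M"
  shows "sset_map (horn (Suc n) k) (underlying_sset (eilenberg_maclane M n))
           (\<lambda>j x. \<lambda>y\<in>simplices (sphere n) j - {None}. if y = Some x then b else \<one>\<^bsub>M\<^esub>)"
    (is "sset_map _ ?K ?f")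
proof -
  interpret M: comm_monoid M by (rule M)
  have closed: "?f j x \<in> simplices ?K j" for j x
    using b by (auto simp: simplices_eilenberg_maclane)
  have "?f l (pull (horn (Suc n) k) p l \<theta> x) = pull ?K p l \<theta> (?f p x)"
    if th: "\<theta> \<in> ord_maps l p" and x: "x \<in> simplices (horn (Suc n) k) p" for p l \<theta> x
  proof -
    let ?S = "\<lambda>j. simplices (sphere n) j - {None}"
    let ?x\<theta> = "compose {..l} x \<theta>"
    have "finprod M (?f p x) {z \<in> ?S p. pull (sphere n) p l \<theta> z = y}
        = (if y = Some ?x\<theta> then b else \<one>\<^bsub>M\<^esub>)" (is "finprod M _ ?A = _")
      if y: "y \<in> ?S l" for y
    proof -
      have "finprod M (?f p x) ?A = finprod M (\<lambda>z. if Some x = z then b else \<one>\<^bsub>M\<^esub>) ?A"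
        by (rule M.finprod_cong') (use b in auto)
      also have "\<dots> = (if Some x \<in> ?A then b else \<one>\<^bsub>M\<^esub>)"
      proof (cases "Some x \<in> ?A")
        case True
        then show ?thesis
          using M.finprod_singleton[of "Some x" ?A "\<lambda>_. b"] b finite_simplices_sphere[of n p]
          by simp
      next
        case False
        then have "finprod M (\<lambda>z. if Some x = z then b else \<one>\<^bsub>M\<^esub>) ?A = \<one>\<^bsub>M\<^esub>"
          by (intro M.finprod_one_eqI) auto
        then show ?thesis using False by (simp only: if_False)
      qed
      also have "Some x \<in> ?A \<longleftrightarrow> y = Some ?x\<theta>"
      proof
        assume "Some x \<in> ?A"
        then show "y = Some ?x\<theta>"
          using y by (auto simp: pull_sphere_Some split: if_splits)
      next
        assume y_eq: "y = Some ?x\<theta>"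
        with y have surj: "?x\<theta> ` {..l} = {..n}" by (auto simp: simplices_sphere)
        have "?x\<theta> ` {..l} \<subseteq> x ` {..p}"
          using th by (auto simp: compose_def ord_maps_def)
        with surj have "{..n} \<subseteq> x ` {..p}" by simp
        from horn_simplex_last_face[OF x this] surj show "Some x \<in> ?A"
          by (auto simp: simplices_sphere pull_sphere_Some y_eq)
      qed
      finally show ?thesis .
    qed
    then show ?thesis
      unfolding pull_eilenberg_maclane[OF M closed]
      by (simp add: pull_horn std_simplex_def cong: restrict_cong)
  qed
  then show ?thesis
    using closed by (auto simp: sset_map_def)
qed

theorem group_if_quasi_category_eilenberg_maclane:
  assumes M: "comm_monoid M" and n: "n \<ge> 2"
    and qc: "quasi_category (underlying_sset (eilenberg_maclane M n))"
  shows "group M"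
proof -
  interpret M: comm_monoid M by (rule M)
  let ?K = "underlying_sset (eilenberg_maclane M n)"
  let ?H = "horn (Suc n) (n - 1)"
  let ?S = "\<lambda>j. simplices (sphere n) j - {None}"
  let ?id = "\<lambda>m. \<lambda>i\<in>{..m}. i"
  have "\<exists>c\<in>carrier M. c \<otimes>\<^bsub>M\<^esub> b = \<one>\<^bsub>M\<^esub>" if b: "b \<in> carrier M" for b
  proof -
    let ?f = "\<lambda>j x. \<lambda>y\<in>?S j. if y = Some x then b else \<one>\<^bsub>M\<^esub>"
    have "n - 1 \<in> {..Suc n} - {0, Suc n}" using n by auto
    from qc[unfolded quasi_category_def, rule_format, OF this sset_map_last_face_horn[OF M b]]
    obtain g where g: "sset_map (std_simplex (Suc n)) ?K g"
      and g_horn: "\<And>j x. x \<in> simplices ?H j \<Longrightarrow> g j x = ?f j x"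
      by blast
    define u where "u = g (Suc n) (?id (Suc n))"
    have id_ord: "?id (Suc n) \<in> simplices (std_simplex (Suc n)) (Suc n)"
      by (auto simp: std_simplex_def ord_maps_def mono_on_def)
    then have u: "u \<in> simplices ?K (Suc n)"
      using g unfolding u_def sset_map_def by blast
    then have u_carrier: "u z \<in> carrier M" if "z \<in> ?S (Suc n)" for z
      using that by (auto simp: simplices_eilenberg_maclane)
    define F where
      "F i = {z \<in> ?S (Suc n). pull (sphere n) (Suc n) n (face_map (Suc n) i) z = Some (?id n)}" for i
    have id_S: "Some (?id n) \<in> ?S n"
      by (auto simp: simplices_sphere ord_maps_def mono_on_def)
    have face: "finprod M u (F i) = (if ?id n = face_map (Suc n) i then b else \<one>\<^bsub>M\<^esub>)"
      if i: "i \<le> Suc n" "i \<noteq> n - 1" for i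
    proof -
      have ord: "face_map (Suc n) i \<in> ord_maps n (Suc n)"
        using face_map_ord_maps[of "Suc n" i] i by simp
      have "pull (std_simplex (Suc n)) (Suc n) n (face_map (Suc n) i) (?id (Suc n))
          = face_map (Suc n) i"
        using ord by (auto simp: std_simplex_def compose_def face_map_def)
      then have "pull ?K (Suc n) n (face_map (Suc n) i) u = g n (face_map (Suc n) i)"
        using g id_ord ord unfolding u_def sset_map_def by metis
      also have "\<dots> = ?f n (face_map (Suc n) i)"
        using g_horn face_map_in_horn[OF i] by simp
      finally have "pull ?K (Suc n) n (face_map (Suc n) i) u (Some (?id n))
          = ?f n (face_map (Suc n) i) (Some (?id n))" by simp
      then show ?thesis
        using id_S unfolding pull_eilenberg_maclane[OF M u] F_def by simp
    qed
    have "?id n = face_map (Suc n) (Suc n)" by (auto simp: face_map_def)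
    then have last: "finprod M u (F (Suc n)) = b" using face[of "Suc n"] n by simp
    have "?id n n \<noteq> face_map (Suc n) n n" by (simp add: face_map_def)
    then have "?id n \<noteq> face_map (Suc n) n" by metis
    then have prev: "finprod M u (F n) = \<one>\<^bsub>M\<^esub>" using face[of n] n by simp
    \<comment> \<open>The only member of \<open>F (Suc n)\<close> is the degeneracy that repeats the value \<open>n\<close>, the index of
      the summand that the two faces share.\<close>
    have "F (Suc n) \<subseteq> F n"
    proof
      fix z assume "z \<in> F (Suc n)"
      then obtain \<sigma> where z: "z = Some \<sigma>" and \<sigma>: "\<sigma> \<in> ord_maps (Suc n) n" "\<sigma> ` {..Suc n} = {..n}"
        and eq: "compose {..n} \<sigma> (face_map (Suc n) (Suc n)) = ?id n"
        by (auto simp: F_def simplices_sphere pull_sphere_Some split: if_splits)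
      have \<sigma>_id: "\<sigma> i = i" if "i \<le> n" for i
        using fun_cong[OF eq, of i] that by (simp add: compose_def face_map_def)
      have "\<sigma> n \<le> \<sigma> (Suc n)" "\<sigma> (Suc n) \<le> n"
        using \<sigma>(1) by (auto simp: ord_maps_def mono_on_def)
      then have "\<sigma> (Suc n) = n" using \<sigma>_id[of n] by simp
      then have "compose {..n} \<sigma> (face_map (Suc n) n) = ?id n"
        using \<sigma>_id by (auto simp: compose_def face_map_def fun_eq_iff)
      then show "z \<in> F n"
        using \<sigma> by (auto simp: F_def z simplices_sphere pull_sphere_Some)
    qed
    then have F_n: "F n - F (Suc n) \<union> F (Suc n) = F n" by blast
    have fin: "finite (F i)" for i
      by (simp add: F_def finite_simplices_sphere)
    have F_carrier: "u \<in> F i \<rightarrow> carrier M" for i using u_carrier by (auto simp: F_def)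
    have "finprod M u (F n - F (Suc n) \<union> F (Suc n))
        = finprod M u (F n - F (Suc n)) \<otimes>\<^bsub>M\<^esub> finprod M u (F (Suc n))"
      by (rule M.finprod_Un_disjoint) (use fin F_carrier in auto)
    moreover have "finprod M u (F n - F (Suc n)) \<in> carrier M"
      using F_carrier by (intro M.finprod_closed) auto
    ultimately show ?thesis using last prev F_n by metis
  qed
  then show ?thesis by (rule M.group_l_invI)
qed

theorem theorem2p3:
  shows "\<exists>(M :: nat monoid) (n :: nat). comm_monoid M \<and> n \<ge> 1 \<and>
           \<not> quasi_category (underlying_sset (eilenberg_maclane M n))"
proof -
  define N :: "nat monoid" where "N = \<lparr>carrier = UNIV, monoid.mult = (+), one = 0\<rparr>"
  have N: "comm_monoid N" by (rule comm_monoidI) (auto simp: N_def)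
  have "\<not> group N"
  proof
    assume "group N"
    then interpret group N .
    have "inv\<^bsub>N\<^esub> 1 \<otimes>\<^bsub>N\<^esub> 1 = \<one>\<^bsub>N\<^esub>" by (rule l_inv) (simp add: N_def)
    then show False by (simp add: N_def)
  qed
  with N have "\<not> quasi_category (underlying_sset (eilenberg_maclane N 2))"
    using group_if_quasi_category_eilenberg_maclane[OF N, of 2] by auto
  with N show ?thesis by (intro exI[of _ N] exI[of _ 2]) simp
qed

end
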